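(* Let $G$ be a graph. Then $\gamma(G)\le d_d(a)\le \Gamma(G)$ for every vertex $a\in V(G)$.
   Context: Graphs are finite, simple and undirected, with nonempty vertex set. A dominating set of a graph $G$ is a set $D\subseteq V(G)$ such that every vertex in $V(G)\setminus D$ is adjacent to some vertex of $D$. A minimal dominating set is a dominating set that does not properly contain any other dominating set. The domination number $\gamma(G)$ is the minimum cardinality of a dominating set of $G$; the upper domination number $\Gamma(G)$ is the maximum cardinality of a minimal dominating set of $G$. The domination degree of a vertex $a$ is $d_d(a)=\min\{|D| : D \text{ is a minimal dominating set of } G \text{ with } a\in D\}$. *)

theory Defs
  imports "Graph_Theory.Digraph"
begin

text \<open>
  A finite simple undirected graph is a \<^locale>\<open>graph\<close>: a finite, loop-free, symmetric digraph
  without parallel arcs, each edge being a pair of opposite arcs. The null graph is not excluded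
  by that locale.
\<close>

definition dominating_set :: "('a, 'b) pre_digraph \<Rightarrow> 'a set \<Rightarrow> bool" where
  "dominating_set G D \<longleftrightarrow>
     D \<subseteq> verts G \<and> (\<forall>v \<in> verts G - D. \<exists>u \<in> D. v \<rightarrow>\<^bsub>G\<^esub> u)"

definition minimal_dominating_set :: "('a, 'b) pre_digraph \<Rightarrow> 'a set \<Rightarrow> bool" where
  "minimal_dominating_set G D \<longleftrightarrow>
     dominating_set G D \<and> \<not> (\<exists>D'. dominating_set G D' \<and> D' \<subset> D)"

text \<open>
  In a finite graph the sets of cardinalities below are finite. The set in the definition of
  \<open>domination_degree\<close> is nonempty for each vertex \<open>a\<close> of a graph, since a maximal independent
  set containing \<open>a\<close> is a minimal dominating set; so neither \<^const>\<open>Min\<close> nor \<^const>\<open>Max\<close> is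
  applied to the empty set.
\<close>

definition domination_number :: "('a, 'b) pre_digraph \<Rightarrow> nat" where
  "domination_number G = Min {card D | D. dominating_set G D}"

definition upper_domination_number :: "('a, 'b) pre_digraph \<Rightarrow> nat" where
  "upper_domination_number G = Max {card D | D. minimal_dominating_set G D}"

definition domination_degree :: "('a, 'b) pre_digraph \<Rightarrow> 'a \<Rightarrow> nat" where
  "domination_degree G a = Min {card D | D. minimal_dominating_set G D \<and> a \<in> D}"

end

theory Submission
  imports Defs
begin

text \<open>
  Once the three families of cardinalities are known to be finite and nonempty, the inequalities
  compare extrema over nested families: the minimal dominating sets through \<open>a\<close> are among all
  minimal dominating sets, which are among all dominating sets. So a minimum over the first family
  is at least the minimum over the last, and at most the maximum over the middle one.

  The substance is that the first family is nonempty. Shrinking an arbitrary dominating set that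
  contains \<open>a\<close> down to a minimal one does not show this, since \<open>a\<close> may be lost on the way. Instead
  \<open>{a}\<close> is enlarged to a maximal independent set: maximality makes it dominating, and independence
  makes every vertex of it indispensable (\<open>maximal_independent_imp_minimal_dominating\<close>).
\<close>

definition independent_set :: "('a, 'b) pre_digraph \<Rightarrow> 'a set \<Rightarrow> bool" where
  "independent_set G S \<longleftrightarrow> S \<subseteq> verts G \<and> (\<forall>u \<in> S. \<forall>v \<in> S. \<not> u \<rightarrow>\<^bsub>G\<^esub> v)"

lemma (in graph) independent_singleton:
  assumes "a \<in> verts G"
  shows "independent_set G {a}"
  using assms adj_not_same unfolding independent_set_def by blast

lemma (in fin_digraph) independent_set_extends_to_maximal:
  assumes "independent_set G S"
  obtains M where "S \<subseteq> M" "independent_set G M"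
    "\<And>T. independent_set G T \<Longrightarrow> M \<subseteq> T \<Longrightarrow> T = M"
proof -
  have "finite {T. independent_set G T}"
    by (rule finite_subset[of _ "Pow (verts G)"]) (auto simp: independent_set_def)
  from finite_has_maximal2[OF this, of S] assms
  obtain M where M: "S \<subseteq> M" "independent_set G M"
    and maximal: "\<forall>T \<in> {T. independent_set G T}. M \<subseteq> T \<longrightarrow> M = T"
    by auto
  show thesis
    by (rule that[OF M]) (use maximal in auto)
qed

text \<open>
  A vertex outside a maximal independent set has a neighbour inside, for otherwise it could be
  added. A vertex inside has no neighbour inside, so once it is removed nothing dominates it.
\<close>

lemma (in graph) maximal_independent_imp_minimal_dominating:
  assumes indep: "independent_set G M"
    and maximal: "\<And>T. independent_set G T \<Longrightarrow> M \<subseteq> T \<Longrightarrow> T = M"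
  shows "minimal_dominating_set G M"
proof -
  have "\<exists>u \<in> M. v \<rightarrow>\<^bsub>G\<^esub> u" if v: "v \<in> verts G - M" for v
  proof (rule ccontr)
    assume none: "\<not> (\<exists>u \<in> M. v \<rightarrow>\<^bsub>G\<^esub> u)"
    have "\<not> v \<rightarrow>\<^bsub>G\<^esub> v"
      using adj_not_same by blast
    moreover have "\<not> u \<rightarrow>\<^bsub>G\<^esub> v" if "u \<in> M" for u
      using none that arcs_ends_symmetric[OF sym_arcs] by blast
    ultimately have "independent_set G (insert v M)"
      using indep none v unfolding independent_set_def by blast
    with maximal v show False
      by blast
  qed
  then have "dominating_set G M"
    using indep unfolding dominating_set_def independent_set_def by blast
  moreover have "\<not> dominating_set G D" if "D \<subset> M" for D
    using that indep unfolding dominating_set_def independent_set_def by blast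
  ultimately show ?thesis
    unfolding minimal_dominating_set_def by blast
qed

lemma (in graph) ex_minimal_dominating_set_containing:
  assumes "a \<in> verts G"
  shows "\<exists>D. minimal_dominating_set G D \<and> a \<in> D"
proof -
  obtain M where "{a} \<subseteq> M" "independent_set G M"
    "\<And>T. independent_set G T \<Longrightarrow> M \<subseteq> T \<Longrightarrow> T = M"
    using independent_set_extends_to_maximal[OF independent_singleton[OF assms]] by blast
  then show ?thesis
    using maximal_independent_imp_minimal_dominating by blast
qed

lemma (in fin_digraph) finite_dominating_sets: "finite {D. dominating_set G D}"
  by (rule finite_subset[of _ "Pow (verts G)"]) (auto simp: dominating_set_def)

theorem proposition3p4:
  fixes G :: "('a, 'b) pre_digraph"
  assumes "graph G" and "verts G \<noteq> {}"
  shows "\<forall>a \<in> verts G. domination_number G \<le> domination_degree G a \<and>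
           domination_degree G a \<le> upper_domination_number G"
proof
  interpret graph G by fact
  fix a
  assume a: "a \<in> verts G"
  let ?dom = "{card D | D. dominating_set G D}"
  let ?min = "{card D | D. minimal_dominating_set G D}"
  let ?deg = "{card D | D. minimal_dominating_set G D \<and> a \<in> D}"
  have "finite ?dom"
    using finite_dominating_sets by simp
  moreover have min_dom: "?min \<subseteq> ?dom"
    unfolding minimal_dominating_set_def by blast
  ultimately have fin_min: "finite ?min"
    using finite_subset by blast
  have deg_min: "?deg \<subseteq> ?min"
    by blast
  have nonempty: "?deg \<noteq> {}"
    using ex_minimal_dominating_set_containing[OF a] by blast
  have "Min ?dom \<le> Min ?deg"
    using Min_antimono[OF subset_trans[OF deg_min min_dom] nonempty \<open>finite ?dom\<close>] .
  moreover have "Min ?deg \<le> Max ?min"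
  proof -
    have "Min ?deg \<in> ?min"
      using Min_in[OF finite_subset[OF deg_min fin_min] nonempty] deg_min by (rule rev_subsetD)
    then show ?thesis
      by (rule Max_ge[OF fin_min])
  qed
  ultimately show "domination_number G \<le> domination_degree G a \<and>
      domination_degree G a \<le> upper_domination_number G"
    unfolding domination_number_def domination_degree_def upper_domination_number_def by blast
qed

end
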